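(* Let $R$ be a $G$-graded ring. Then: (a) $\mathrm{Spec}_G(R)$ with the Zariski topology is a Noetherian topological space if and only if the ascending chain condition holds for graded radical ideals of $R$. (b) If $R$ is a graded Noetherian ring, then $\mathrm{Spec}_G(R)$ is a Noetherian topological space.
   Context: $G$ is an abelian group with identity $e$; all rings are commutative with unity $1$. A $G$-graded ring is a ring $R=\bigoplus_{g\in G}R_g$ with additive subgroups $R_g$ satisfying $R_gR_h\subseteq R_{gh}$; $h(R)=\bigcup_{g}R_g$ is the set of homogeneous elements. An ideal $I$ of $R$ is graded (written $I\lhd_G R$) if $I=\bigoplus_g (I\cap R_g)$. A graded prime ideal is a proper graded ideal $p$ such that for $a,b\in h(R)$, $ab\in p$ implies $a\in p$ or $b\in p$; $\mathrm{Spec}_G(R)$ is the set of all graded prime ideals. For $J\lhd_G R$ put $V_G^R(J)=\{p\in \mathrm{Spec}_G(R): J\subseteq p\}$; the sets $V_G^R(J)$ are the closed sets of the Zariski topology on $\mathrm{Spec}_G(R)$. The graded radical $Gr(I)$ of a graded ideal $I$ is the set of all $a=\sum_g a_g\in R$ (with $a_g\in R_g$) such that for each $g$ there is $n_g>0$ with $a_g^{n_g}\in I$; $I$ is a graded radical ideal if $I=Gr(I)$. $R$ is graded Noetherian if it satisfies the ascending chain condition on graded ideals. A topological space is Noetherian if its closed sets satisfy the descending chain condition. *)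

theory Defs
  imports "HOL-Algebra.Algebra" "HOL-Analysis.Abstract_Topology"
begin

text \<open>
  The external direct sum of a family of subsets, realised as the finitely supported families;
  they are required to be extensional, so that a family is determined by its values on the
  index set.
\<close>

definition fin_supp_families ::
    "('a, 'n) ring_scheme \<Rightarrow> 'i set \<Rightarrow> ('i \<Rightarrow> 'a set) \<Rightarrow> ('i \<Rightarrow> 'a) set" where
  "fin_supp_families R I B = {f \<in> Pi\<^sub>E I B. finite {i \<in> I. f i \<noteq> \<zero>\<^bsub>R\<^esub>}}"

text \<open>
  The sum is restricted to the support, because \<^const>\<open>finsum\<close> is \<open>\<zero>\<close> on infinite index sets.
\<close>

definition family_sum :: "('a, 'n) ring_scheme \<Rightarrow> 'i set \<Rightarrow> ('i \<Rightarrow> 'a) \<Rightarrow> 'a" where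
  "family_sum R I f = finsum R f {i \<in> I. f i \<noteq> \<zero>\<^bsub>R\<^esub>}"

definition internal_direct_sum ::
    "('a, 'n) ring_scheme \<Rightarrow> 'i set \<Rightarrow> ('i \<Rightarrow> 'a set) \<Rightarrow> 'a set \<Rightarrow> bool" where
  "internal_direct_sum R I B S \<longleftrightarrow>
     (\<forall>i\<in>I. additive_subgroup (B i) R) \<and>
     bij_betw (family_sum R I) (fin_supp_families R I B) S"

locale graded_ring = G: comm_group G + R: cring R
  for G :: "('g, 'm) monoid_scheme" and R :: "('a, 'n) ring_scheme" +
  fixes A :: "'g \<Rightarrow> 'a set"
  assumes decomposition: "internal_direct_sum R (carrier G) A (carrier R)"
    and graded_mult:
      "\<lbrakk>g \<in> carrier G; h \<in> carrier G; a \<in> A g; b \<in> A h\<rbrakk> \<Longrightarrow> a \<otimes>\<^bsub>R\<^esub> b \<in> A (g \<otimes>\<^bsub>G\<^esub> h)"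

definition homogeneous :: "('g, 'm) monoid_scheme \<Rightarrow> ('g \<Rightarrow> 'a set) \<Rightarrow> 'a set" where
  "homogeneous G A = (\<Union>g\<in>carrier G. A g)"

definition graded_ideal ::
    "('g, 'm) monoid_scheme \<Rightarrow> ('a, 'n) ring_scheme \<Rightarrow> ('g \<Rightarrow> 'a set) \<Rightarrow> 'a set \<Rightarrow> bool" where
  "graded_ideal G R A J \<longleftrightarrow>
     ideal J R \<and> internal_direct_sum R (carrier G) (\<lambda>g. J \<inter> A g) J"

definition graded_prime ::
    "('g, 'm) monoid_scheme \<Rightarrow> ('a, 'n) ring_scheme \<Rightarrow> ('g \<Rightarrow> 'a set) \<Rightarrow> 'a set \<Rightarrow> bool" where
  "graded_prime G R A p \<longleftrightarrow>
     graded_ideal G R A p \<and> p \<noteq> carrier R \<and>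
     (\<forall>a\<in>homogeneous G A. \<forall>b\<in>homogeneous G A. a \<otimes>\<^bsub>R\<^esub> b \<in> p \<longrightarrow> a \<in> p \<or> b \<in> p)"

definition graded_Spec ::
    "('g, 'm) monoid_scheme \<Rightarrow> ('a, 'n) ring_scheme \<Rightarrow> ('g \<Rightarrow> 'a set) \<Rightarrow> 'a set set" where
  "graded_Spec G R A = {p. graded_prime G R A p}"

definition graded_V ::
    "('g, 'm) monoid_scheme \<Rightarrow> ('a, 'n) ring_scheme \<Rightarrow> ('g \<Rightarrow> 'a set) \<Rightarrow> 'a set \<Rightarrow> 'a set set" where
  "graded_V G R A J = {p \<in> graded_Spec G R A. J \<subseteq> p}"

text \<open>
  That this really is a topology, whose closed sets are exactly the sets \<^const>\<open>graded_V\<close>, is shown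
  in \<open>graded_ring.closedin_zariski_iff\<close>.
\<close>

definition graded_zariski ::
    "('g, 'm) monoid_scheme \<Rightarrow> ('a, 'n) ring_scheme \<Rightarrow> ('g \<Rightarrow> 'a set) \<Rightarrow> 'a set topology" where
  "graded_zariski G R A =
     topology (\<lambda>U. \<exists>J. graded_ideal G R A J \<and> U = graded_Spec G R A - graded_V G R A J)"

definition graded_radical ::
    "('g, 'm) monoid_scheme \<Rightarrow> ('a, 'n) ring_scheme \<Rightarrow> ('g \<Rightarrow> 'a set) \<Rightarrow> 'a set \<Rightarrow> 'a set" where
  "graded_radical G R A J =
     {family_sum R (carrier G) f |f. f \<in> fin_supp_families R (carrier G) A \<and>
        (\<forall>g\<in>carrier G. \<exists>n::nat. n > 0 \<and> f g [^]\<^bsub>R\<^esub> n \<in> J)}"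

definition graded_radical_ideal ::
    "('g, 'm) monoid_scheme \<Rightarrow> ('a, 'n) ring_scheme \<Rightarrow> ('g \<Rightarrow> 'a set) \<Rightarrow> 'a set \<Rightarrow> bool" where
  "graded_radical_ideal G R A J \<longleftrightarrow> graded_ideal G R A J \<and> J = graded_radical G R A J"

definition acc_for :: "('a set \<Rightarrow> bool) \<Rightarrow> bool" where
  "acc_for P \<longleftrightarrow>
     (\<forall>J :: nat \<Rightarrow> 'a set. (\<forall>n. P (J n)) \<and> (\<forall>n. J n \<subseteq> J (Suc n)) \<longrightarrow> (\<exists>N. \<forall>n\<ge>N. J n = J N))"

definition graded_noetherian ::
    "('g, 'm) monoid_scheme \<Rightarrow> ('a, 'n) ring_scheme \<Rightarrow> ('g \<Rightarrow> 'a set) \<Rightarrow> bool" where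
  "graded_noetherian G R A \<longleftrightarrow> acc_for (graded_ideal G R A)"

definition noetherian_space :: "'a topology \<Rightarrow> bool" where
  "noetherian_space T \<longleftrightarrow>
     (\<forall>C :: nat \<Rightarrow> 'a set. (\<forall>n. closedin T (C n)) \<and> (\<forall>n. C (Suc n) \<subseteq> C n) \<longrightarrow>
        (\<exists>N. \<forall>n\<ge>N. C n = C N))"


context graded_ring
begin

lemma A_additive_subgroup: "g \<in> carrier G \<Longrightarrow> additive_subgroup (A g) R"
  using decomposition by (auto simp: internal_direct_sum_def)

lemma A_subset: "g \<in> carrier G \<Longrightarrow> A g \<subseteq> carrier R"
  using A_additive_subgroup additive_subgroup.a_subset by blast

lemma ideal_finsum_closed:
  assumes J: "ideal J R" and "finite S" "f \<in> S \<rightarrow> J"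
  shows "finsum R f S \<in> J"
proof -
  interpret J: ideal J R by (rule J)
  have JR: "J \<subseteq> carrier R" using J.a_subset .
  show ?thesis
    using assms(2,3)
  proof (induction S rule: finite_induct)
    case empty
    then show ?case by (simp add: J.zero_closed)
  next
    case (insert x F)
    then have "finsum R f (insert x F) = f x \<oplus>\<^bsub>R\<^esub> finsum R f F"
      using JR by (intro R.finsum_insert) auto
    then show ?case using insert by (auto intro: J.a_closed)
  qed
qed

lemma graded_ideal_iff:
  assumes J: "ideal J R"
  shows "graded_ideal G R A J \<longleftrightarrow>
     (\<forall>f\<in>fin_supp_families R (carrier G) A.
        family_sum R (carrier G) f \<in> J \<longrightarrow> (\<forall>g\<in>carrier G. f g \<in> J))"
    (is "_ = ?rhs")
proof -
  interpret J: ideal J R by (rule J)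
  let ?F = "fin_supp_families R (carrier G) A"
  let ?FJ = "fin_supp_families R (carrier G) (\<lambda>g. J \<inter> A g)"
  let ?s = "family_sum R (carrier G)"
  have bij: "bij_betw ?s ?F (carrier R)"
    using decomposition by (auto simp: internal_direct_sum_def)
  have sub: "?FJ \<subseteq> ?F" by (auto simp: fin_supp_families_def PiE_iff)
  have add: "\<forall>g\<in>carrier G. additive_subgroup (J \<inter> A g) R"
    using A_additive_subgroup J.additive_subgroup_axioms
    by (auto simp: additive_subgroup_def intro: group.subgroups_Inter_pair R.a_group)
  have inJ: "?s f \<in> J" if "f \<in> ?FJ" for f
    unfolding family_sum_def using that
    by (intro ideal_finsum_closed J) (auto simp: fin_supp_families_def PiE_iff)
  show ?thesis
  proof
    assume "graded_ideal G R A J"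
    then have im: "?s ` ?FJ = J"
      by (auto simp: graded_ideal_def internal_direct_sum_def bij_betw_def)
    show ?rhs
    proof (intro ballI impI)
      fix f g assume f: "f \<in> ?F" "?s f \<in> J" and g: "g \<in> carrier G"
      then obtain f' where f': "f' \<in> ?FJ" "?s f' = ?s f" using im by (metis imageE)
      then have "f' = f"
        using bij sub f by (auto simp: bij_betw_def dest: inj_onD)
      then show "f g \<in> J" using f' g by (auto simp: fin_supp_families_def PiE_iff)
    qed
  next
    assume r: ?rhs
    have "J \<subseteq> ?s ` ?FJ"
    proof
      fix x assume x: "x \<in> J"
      then have "x \<in> ?s ` ?F"
        using bij J.a_subset by (auto simp: bij_betw_def)
      then obtain f where f: "f \<in> ?F" "x = ?s f" by auto
      then have "f \<in> ?FJ"
        using r x by (auto simp: fin_supp_families_def PiE_iff)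
      then show "x \<in> ?s ` ?FJ" using f by auto
    qed
    then have "bij_betw ?s ?FJ J"
      using inJ bij sub by (auto simp: bij_betw_def intro: inj_on_subset)
    then show "graded_ideal G R A J"
      using J add by (simp add: graded_ideal_def internal_direct_sum_def)
  qed
qed

lemma graded_ideal_Inter:
  assumes "\<And>J. J \<in> S \<Longrightarrow> graded_ideal G R A J" "S \<noteq> {}"
  shows "graded_ideal G R A (\<Inter>S)"
proof -
  have i: "ideal J R" if "J \<in> S" for J using assms(1)[OF that] by (simp add: graded_ideal_def)
  have I: "ideal (\<Inter>S) R" using i assms(2) by (intro R.i_Intersect)
  show ?thesis
    unfolding graded_ideal_iff[OF I] using assms(1) graded_ideal_iff i by blast
qed

lemma graded_ideal_carrier: "graded_ideal G R A (carrier R)"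
  unfolding graded_ideal_iff[OF R.oneideal]
  using A_subset by (auto simp: fin_supp_families_def PiE_iff)

lemma graded_ideal_homogeneous_witness:
  assumes J: "graded_ideal G R A J" and p: "ideal p R" and "\<not> J \<subseteq> p"
  obtains a where "a \<in> homogeneous G A" "a \<in> J" "a \<notin> p"
proof -
  obtain x where x: "x \<in> J" "x \<notin> p" using assms by auto
  have "J = family_sum R (carrier G) ` fin_supp_families R (carrier G) (\<lambda>g. J \<inter> A g)"
    using J by (auto simp: graded_ideal_def internal_direct_sum_def bij_betw_def)
  then obtain f where f: "f \<in> fin_supp_families R (carrier G) (\<lambda>g. J \<inter> A g)"
      "x = family_sum R (carrier G) f"
    using x by blast
  have "\<exists>g\<in>carrier G. f g \<notin> p"
  proof (rule ccontr)
    assume "\<not> ?thesis"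
    then have "x \<in> p"
      unfolding f(2) family_sum_def using f(1)
      by (intro ideal_finsum_closed p) (auto simp: fin_supp_families_def)
    then show False using x by simp
  qed
  then obtain g where "g \<in> carrier G" "f g \<notin> p" by auto
  then show thesis
    using f(1) that[of "f g"] by (auto simp: fin_supp_families_def homogeneous_def PiE_iff)
qed

lemma homogeneous_subset: "homogeneous G A \<subseteq> carrier R"
  using A_subset by (auto simp: homogeneous_def)

lemma graded_V_Int:
  assumes I: "graded_ideal G R A I" and J: "graded_ideal G R A J"
  shows "graded_V G R A (I \<inter> J) = graded_V G R A I \<union> graded_V G R A J"
proof -
  have "I \<subseteq> p \<or> J \<subseteq> p" if p: "graded_prime G R A p" and sub: "I \<inter> J \<subseteq> p" for p
  proof (rule ccontr)
    assume n: "\<not> ?thesis"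
    have pi: "ideal p R" using p by (simp add: graded_prime_def graded_ideal_def)
    obtain a where a: "a \<in> homogeneous G A" "a \<in> I" "a \<notin> p"
      using graded_ideal_homogeneous_witness[OF I pi] n by blast
    obtain b where b: "b \<in> homogeneous G A" "b \<in> J" "b \<notin> p"
      using graded_ideal_homogeneous_witness[OF J pi] n by blast
    have "a \<otimes>\<^bsub>R\<^esub> b \<in> I" "a \<otimes>\<^bsub>R\<^esub> b \<in> J"
      using I J a b homogeneous_subset
      by (auto simp: graded_ideal_def intro: ideal.I_r_closed ideal.I_l_closed)
    then show False using p a b sub by (auto simp: graded_prime_def)
  qed
  then show ?thesis by (auto simp: graded_V_def graded_Spec_def)
qed

lemma istopology_zariski:
  "istopology (\<lambda>U. \<exists>J. graded_ideal G R A J \<and> U = graded_Spec G R A - graded_V G R A J)"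
    (is "istopology ?O")
  unfolding istopology_def
proof (intro conjI allI impI)
  fix U W assume "?O U" "?O W"
  then obtain I J where IJ: "graded_ideal G R A I" "U = graded_Spec G R A - graded_V G R A I"
      "graded_ideal G R A J" "W = graded_Spec G R A - graded_V G R A J"
    by blast
  have "graded_ideal G R A (\<Inter>{I, J})" using IJ by (intro graded_ideal_Inter) auto
  then show "?O (U \<inter> W)"
    using IJ graded_V_Int[of I J] by (intro exI[of _ "I \<inter> J"]) auto
next
  fix K assume "\<forall>U\<in>K. ?O U"
  then obtain J where J: "\<And>U. U \<in> K \<Longrightarrow> graded_ideal G R A (J U)"
      "\<And>U. U \<in> K \<Longrightarrow> U = graded_Spec G R A - graded_V G R A (J U)"
    by metis
  define S where "S = {I. graded_ideal G R A I \<and> (\<forall>U\<in>K. J U \<subseteq> I)}"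
  have "carrier R \<in> S"
    unfolding S_def using J(1) graded_ideal_carrier
    by (auto simp: graded_ideal_def dest: ideal.Icarr)
  then have gr: "graded_ideal G R A (\<Inter>S)"
    by (intro graded_ideal_Inter) (auto simp: S_def)
  have V: "\<Inter>S \<subseteq> p \<longleftrightarrow> (\<forall>U\<in>K. J U \<subseteq> p)" if p: "p \<in> graded_Spec G R A" for p
  proof
    assume "\<Inter>S \<subseteq> p"
    moreover have "J U \<subseteq> \<Inter>S" if "U \<in> K" for U
      using that by (intro Inter_greatest) (simp add: S_def)
    ultimately show "\<forall>U\<in>K. J U \<subseteq> p" by (meson order_trans)
  next
    assume "\<forall>U\<in>K. J U \<subseteq> p"
    then have "p \<in> S" using p by (simp add: S_def graded_Spec_def graded_prime_def)
    then show "\<Inter>S \<subseteq> p" by (rule Inter_lower)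
  qed
  have mem: "p \<in> U \<longleftrightarrow> p \<in> graded_Spec G R A \<and> \<not> J U \<subseteq> p" if "U \<in> K" for p U
    by (subst J(2)[OF that]) (auto simp: graded_V_def)
  have "\<Union>K = graded_Spec G R A - graded_V G R A (\<Inter>S)"
  proof (rule Set.set_eqI)
    fix p
    have "p \<in> \<Union>K \<longleftrightarrow> (\<exists>U\<in>K. p \<in> graded_Spec G R A \<and> \<not> J U \<subseteq> p)"
      unfolding Union_iff using mem by (intro bex_cong) auto
    also have "\<dots> \<longleftrightarrow> p \<in> graded_Spec G R A \<and> \<not> \<Inter>S \<subseteq> p"
      using V[of p] by meson
    finally show "p \<in> \<Union>K \<longleftrightarrow> p \<in> graded_Spec G R A - graded_V G R A (\<Inter>S)"
      by (auto simp: graded_V_def)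
  qed
  with gr show "?O (\<Union>K)" by (intro exI[of _ "\<Inter>S"] conjI)
qed

lemma openin_zariski_iff:
  "openin (graded_zariski G R A) U \<longleftrightarrow>
     (\<exists>J. graded_ideal G R A J \<and> U = graded_Spec G R A - graded_V G R A J)"
  unfolding graded_zariski_def by (simp add: topology_inverse'[OF istopology_zariski])

lemma topspace_zariski: "topspace (graded_zariski G R A) = graded_Spec G R A"
proof -
  have "graded_V G R A (carrier R) = {}"
    by (auto simp: graded_V_def graded_Spec_def graded_prime_def graded_ideal_def
          dest: ideal.Icarr)
  then have "openin (graded_zariski G R A) (graded_Spec G R A)"
    unfolding openin_zariski_iff using graded_ideal_carrier by auto
  then show ?thesis
    by (metis Diff_subset openin_subset openin_topspace openin_zariski_iff subset_antisym)
qed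

lemma closedin_zariski_iff:
  "closedin (graded_zariski G R A) C \<longleftrightarrow> (\<exists>J. graded_ideal G R A J \<and> C = graded_V G R A J)"
proof -
  have "graded_V G R A J \<subseteq> graded_Spec G R A" for J by (auto simp: graded_V_def)
  then show ?thesis
    unfolding closedin_def topspace_zariski openin_zariski_iff by blast
qed

end

end

theory Submission
  imports Defs
begin

text \<open>
  The map sending a set of graded primes to its intersection inverts \<^const>\<open>graded_V\<close> up to graded
  radicals: \<open>Gr(J)\<close> is the intersection of the graded primes containing \<open>J\<close>. The nontrivial
  inclusion is Krull's argument: if no positive power of a homogeneous \<open>a\<close> lies in \<open>J\<close>, then a
  graded ideal maximal among those that contain \<open>J\<close> and no positive power of \<open>a\<close> is a graded prime.
  Hence descending chains of closed sets correspond to ascending chains of graded radical ideals.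
\<close>

section \<open>Enlarging an ideal by a principal ideal\<close>

lemma (in cring) sum_cgenideal_mult_mem:
  assumes p: "ideal p R" and b: "b \<in> carrier R" and c: "c \<in> carrier R" and bc: "b \<otimes> c \<in> p"
    and x: "x \<in> p <+>\<^bsub>R\<^esub> PIdl b" and y: "y \<in> p <+>\<^bsub>R\<^esub> PIdl c"
  shows "x \<otimes> y \<in> p"
proof -
  interpret p: ideal p R by (rule p)
  obtain u r where u: "u \<in> p" "r \<in> carrier R" "x = u \<oplus> r \<otimes> b"
    using x by (auto simp: set_add_def' cgenideal_def)
  obtain v s where v: "v \<in> p" "s \<in> carrier R" "y = v \<oplus> s \<otimes> c"
    using y by (auto simp: set_add_def' cgenideal_def)
  have uv: "u \<in> carrier R" "v \<in> carrier R" using u v p.Icarr by auto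
  \<comment> \<open>After expansion every summand has a factor \<open>u\<close>, \<open>v\<close> or
    \<open>b \<otimes> c\<close>, all of which lie in \<open>p\<close>.\<close>
  have "x \<otimes> y = u \<otimes> (v \<oplus> s \<otimes> c) \<oplus> (r \<otimes> b \<otimes> v \<oplus> (r \<otimes> s) \<otimes> (b \<otimes> c))"
    unfolding u(3) v(3) using uv b c u(2) v(2) by algebra
  also have "\<dots> \<in> p"
    using p.I_r_closed[OF u(1)] p.I_l_closed[OF v(1)] p.I_l_closed[OF bc] u(2) v(2) uv b c
    by (intro p.a_closed) auto
  finally show ?thesis .
qed

lemma (in cring) cgenideal_sum_contains:
  assumes p: "ideal p R" and b: "b \<in> carrier R"
  shows "p \<subseteq> p <+>\<^bsub>R\<^esub> PIdl b" "b \<in> p <+>\<^bsub>R\<^esub> PIdl b"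
proof -
  interpret p: ideal p R by (rule p)
  interpret B: ideal "PIdl b" R by (rule cgenideal_ideal[OF b])
  have mem: "u \<oplus> v \<in> p <+>\<^bsub>R\<^esub> PIdl b" if "u \<in> p" "v \<in> PIdl b" for u v
    using that unfolding set_add_def' by blast
  show "p \<subseteq> p <+>\<^bsub>R\<^esub> PIdl b"
    using mem[OF _ B.zero_closed] p.Icarr by (metis r_zero subsetI)
  show "b \<in> p <+>\<^bsub>R\<^esub> PIdl b"
    using mem[OF p.zero_closed cgenideal_self[OF b]] b by simp
qed

section \<open>Homogeneous components of sums and products; new graded ideals from old ones\<close>

context graded_ring
begin

abbreviation families :: "('g \<Rightarrow> 'a) set" where
  "families \<equiv> fin_supp_families R (carrier G) A"

lemma family_mem: "f \<in> families \<Longrightarrow> g \<in> carrier G \<Longrightarrow> f g \<in> A g"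
  by (auto simp: fin_supp_families_def)

lemma family_closed: "f \<in> families \<Longrightarrow> g \<in> carrier G \<Longrightarrow> f g \<in> carrier R"
  using family_mem A_subset by blast

lemma family_sum_inj:
  "\<lbrakk>f \<in> families; f' \<in> families; family_sum R (carrier G) f = family_sum R (carrier G) f'\<rbrakk>
    \<Longrightarrow> f = f'"
  using decomposition by (auto simp: internal_direct_sum_def bij_betw_def dest: inj_onD)

lemma family_sum_ex:
  assumes "x \<in> carrier R"
  obtains f where "f \<in> families" "x = family_sum R (carrier G) f"
  using decomposition assms by (auto simp: internal_direct_sum_def bij_betw_def)

lemma family_sum_closed: "f \<in> families \<Longrightarrow> family_sum R (carrier G) f \<in> carrier R"
  using decomposition by (auto simp: internal_direct_sum_def bij_betw_def)

lemma family_sum_mem: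
  assumes "ideal J R" "f \<in> families" "\<And>g. g \<in> carrier G \<Longrightarrow> f g \<in> J"
  shows "family_sum R (carrier G) f \<in> J"
  unfolding family_sum_def using assms
  by (intro ideal_finsum_closed) (auto simp: fin_supp_families_def)

text \<open>\<open>family_sum\<close> sums over the exact support, which cancellation and zero
  products change unpredictably. A finite superset of the support gives the same value and is easier
  to control.\<close>

lemma family_sum_eq_finsum:
  assumes "f \<in> carrier G \<rightarrow> carrier R" "finite S" "S \<subseteq> carrier G"
    and "{g \<in> carrier G. f g \<noteq> \<zero>\<^bsub>R\<^esub>} \<subseteq> S"
  shows "family_sum R (carrier G) f = finsum R f S"
  unfolding family_sum_def using assms
  by (intro R.add.finprod_mono_neutral_cong_left) auto

text \<open>Together with \<open>family_sum_inj\<close> this identifies the components of a sum. The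
  restricted lambda makes \<open>s\<close> extensional, as membership in \<open>families\<close>
  demands.\<close>

lemma family_add:
  assumes f: "f \<in> families" and f': "f' \<in> families"
  defines "s \<equiv> \<lambda>g\<in>carrier G. f g \<oplus>\<^bsub>R\<^esub> f' g"
  shows "s \<in> families"
    and "family_sum R (carrier G) s = family_sum R (carrier G) f \<oplus>\<^bsub>R\<^esub> family_sum R (carrier G) f'"
proof -
  \<comment> \<open>A common index set for all three sums; the support of \<open>s\<close> can be
    strictly smaller, since terms may cancel.\<close>
  define S where "S = {g \<in> carrier G. f g \<noteq> \<zero>\<^bsub>R\<^esub>} \<union> {g \<in> carrier G. f' g \<noteq> \<zero>\<^bsub>R\<^esub>}"
  have S: "finite S" "S \<subseteq> carrier G"
    using f f' by (auto simp: S_def fin_supp_families_def)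
  have supp: "{g \<in> carrier G. s g \<noteq> \<zero>\<^bsub>R\<^esub>} \<subseteq> S"
    by (auto simp: S_def s_def)
  have mem: "s g \<in> A g" if "g \<in> carrier G" for g
    using that A_additive_subgroup[OF that] family_mem[OF f that] family_mem[OF f' that]
    by (simp add: s_def additive_subgroup.a_closed)
  then show "s \<in> families"
    using finite_subset[OF supp S(1)]
    by (simp add: fin_supp_families_def PiE_iff) (simp add: s_def)
  have "family_sum R (carrier G) s = finsum R s S"
    using mem A_subset S supp by (intro family_sum_eq_finsum) auto
  also have "\<dots> = finsum R (\<lambda>g. f g \<oplus>\<^bsub>R\<^esub> f' g) S"
    using S(2) family_closed[OF f] family_closed[OF f']
    by (intro R.finsum_cong') (auto simp: s_def)
  also have "\<dots> = finsum R f S \<oplus>\<^bsub>R\<^esub> finsum R f' S"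
    using S(2) family_closed[OF f] family_closed[OF f'] by (intro R.finsum_addf) auto
  also have "finsum R f S = family_sum R (carrier G) f"
    using family_closed[OF f] S by (intro family_sum_eq_finsum[symmetric]) (auto simp: S_def)
  also have "finsum R f' S = family_sum R (carrier G) f'"
    using family_closed[OF f'] S by (intro family_sum_eq_finsum[symmetric]) (auto simp: S_def)
  finally show "family_sum R (carrier G) s =
    family_sum R (carrier G) f \<oplus>\<^bsub>R\<^esub> family_sum R (carrier G) f'" .
qed

text \<open>Multiplying by \<open>b\<close> of degree \<open>h\<close> moves the component of degree
  \<open>g\<close> to degree \<open>g h\<close>. Read backwards, the component of the product in
  degree \<open>k\<close> comes from degree \<open>k h^-1\<close>, which exists because the degrees
  form a group.\<close>

lemma family_shift:
  assumes f: "f \<in> families" and h: "h \<in> carrier G" and b: "b \<in> A h"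
  defines "s \<equiv> \<lambda>k\<in>carrier G. f (k \<otimes>\<^bsub>G\<^esub> inv\<^bsub>G\<^esub> h) \<otimes>\<^bsub>R\<^esub> b"
  shows "s \<in> families"
    and "family_sum R (carrier G) s = family_sum R (carrier G) f \<otimes>\<^bsub>R\<^esub> b"
proof -
  define T where "T = {g \<in> carrier G. f g \<noteq> \<zero>\<^bsub>R\<^esub>}"
  \<comment> \<open>The translated support of \<open>f\<close>. It only bounds the support of
    \<open>s\<close>, since \<open>f g \<otimes> b\<close> can vanish for nonzero
    \<open>f g\<close>.\<close>
  define S where "S = (\<lambda>g. g \<otimes>\<^bsub>G\<^esub> h) ` T"
  have T: "finite T" "T \<subseteq> carrier G"
    using f by (auto simp: T_def fin_supp_families_def)
  have S: "finite S" "S \<subseteq> carrier G" using T h by (auto simp: S_def)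
  have bR: "b \<in> carrier R" using b A_subset[OF h] by blast
  have cancel: "k \<otimes>\<^bsub>G\<^esub> inv\<^bsub>G\<^esub> h \<otimes>\<^bsub>G\<^esub> h = k" "k \<otimes>\<^bsub>G\<^esub> h \<otimes>\<^bsub>G\<^esub> inv\<^bsub>G\<^esub> h = k"
    if "k \<in> carrier G" for k
    using that h by (simp_all add: G.m_assoc)
  have supp: "{g \<in> carrier G. s g \<noteq> \<zero>\<^bsub>R\<^esub>} \<subseteq> S"
  proof
    fix k assume "k \<in> {g \<in> carrier G. s g \<noteq> \<zero>\<^bsub>R\<^esub>}"
    then have k: "k \<in> carrier G" "s k \<noteq> \<zero>\<^bsub>R\<^esub>" by auto
    then have "k \<otimes>\<^bsub>G\<^esub> inv\<^bsub>G\<^esub> h \<in> T" using bR h by (auto simp: T_def s_def)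
    then have "k \<otimes>\<^bsub>G\<^esub> inv\<^bsub>G\<^esub> h \<otimes>\<^bsub>G\<^esub> h \<in> S" unfolding S_def by blast
    then show "k \<in> S" using cancel k(1) by simp
  qed
  have mem: "s k \<in> A k" if k: "k \<in> carrier G" for k
  proof -
    have k': "k \<otimes>\<^bsub>G\<^esub> inv\<^bsub>G\<^esub> h \<in> carrier G" using k h by simp
    show ?thesis
      using graded_mult[OF k' h family_mem[OF f k'] b] k cancel by (simp add: s_def)
  qed
  then show "s \<in> families"
    using finite_subset[OF supp S(1)]
    by (simp add: fin_supp_families_def PiE_iff) (simp add: s_def)
  have inj: "inj_on (\<lambda>g. g \<otimes>\<^bsub>G\<^esub> h) T"
    using T(2) cancel(2)
    by (intro inj_on_inverseI[of _ "\<lambda>k. k \<otimes>\<^bsub>G\<^esub> inv\<^bsub>G\<^esub> h"]) blast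
  have sS: "s \<in> S \<rightarrow> carrier R" using S(2) mem A_subset by blast
  have "family_sum R (carrier G) s = finsum R s S"
    using mem A_subset S supp by (intro family_sum_eq_finsum) auto
  also have "\<dots> = finsum R (\<lambda>g. s (g \<otimes>\<^bsub>G\<^esub> h)) T"
    using R.finsum_reindex[OF _ inj, of s] sS by (simp add: S_def)
  also have "\<dots> = finsum R (\<lambda>g. f g \<otimes>\<^bsub>R\<^esub> b) T"
    using T(2) h family_closed[OF f] bR cancel
    by (intro R.finsum_cong') (auto simp: s_def subset_iff)
  also have "\<dots> = finsum R f T \<otimes>\<^bsub>R\<^esub> b"
    using T family_closed[OF f] bR by (intro R.finsum_ldistr[symmetric]) auto
  finally show "family_sum R (carrier G) s = family_sum R (carrier G) f \<otimes>\<^bsub>R\<^esub> b"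
    by (simp add: family_sum_def T_def)
qed

text \<open>An element \<open>y + r b\<close> has the component \<open>y_g + r_k b\<close> in degree
  \<open>g\<close>, where \<open>k = g h^-1\<close> and \<open>h\<close> is the degree of
  \<open>b\<close>. Here \<open>y_g\<close> lies in \<open>p\<close> because \<open>p\<close> is
  graded, and the other term is a multiple of \<open>b\<close>.\<close>

lemma graded_ideal_sum_cgenideal:
  assumes p: "graded_ideal G R A p" and "b \<in> homogeneous G A"
  shows "graded_ideal G R A (p <+>\<^bsub>R\<^esub> PIdl\<^bsub>R\<^esub> b)"
proof -
  obtain h where h: "h \<in> carrier G" "b \<in> A h" using assms(2) by (auto simp: homogeneous_def)
  have bR: "b \<in> carrier R" using h A_subset by blast
  have pI: "ideal p R" using p by (simp add: graded_ideal_def)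
  have I: "ideal (p <+>\<^bsub>R\<^esub> PIdl\<^bsub>R\<^esub> b) R"
    using R.add_ideals[OF pI R.cgenideal_ideal[OF bR]] .
  show ?thesis unfolding graded_ideal_iff[OF I]
  proof (intro ballI impI)
    fix f g
    assume f: "f \<in> families" "family_sum R (carrier G) f \<in> p <+>\<^bsub>R\<^esub> PIdl\<^bsub>R\<^esub> b"
      and g: "g \<in> carrier G"
    obtain y r where y: "y \<in> p" and r: "r \<in> carrier R"
      and fs: "family_sum R (carrier G) f = y \<oplus>\<^bsub>R\<^esub> r \<otimes>\<^bsub>R\<^esub> b"
      using f(2) by (auto simp: set_add_def' cgenideal_def)
    obtain fy where fy: "fy \<in> families" "y = family_sum R (carrier G) fy"
      using y pI family_sum_ex by (metis ideal.Icarr)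
    obtain fr where fr: "fr \<in> families" "r = family_sum R (carrier G) fr"
      using r family_sum_ex by metis
    note shift = family_shift[OF fr(1) h]
    note add = family_add[OF fy(1) shift(1)]
    \<comment> \<open>Both families have the sum \<open>y + r b\<close>, so uniqueness of the
      decomposition makes them equal.\<close>
    have "f = (\<lambda>g\<in>carrier G. fy g \<oplus>\<^bsub>R\<^esub>
        (\<lambda>k\<in>carrier G. fr (k \<otimes>\<^bsub>G\<^esub> inv\<^bsub>G\<^esub> h) \<otimes>\<^bsub>R\<^esub> b) g)"
      using f(1) add fs fy(2) fr(2) shift(2) by (intro family_sum_inj) simp_all
    then have "f g = fy g \<oplus>\<^bsub>R\<^esub> fr (g \<otimes>\<^bsub>G\<^esub> inv\<^bsub>G\<^esub> h) \<otimes>\<^bsub>R\<^esub> b" using g by simp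
    moreover have "fy g \<in> p" using p fy y g graded_ideal_iff[OF pI] by blast
    moreover have "fr (g \<otimes>\<^bsub>G\<^esub> inv\<^bsub>G\<^esub> h) \<in> carrier R"
      using family_closed[OF fr(1)] g h by simp
    ultimately show "f g \<in> p <+>\<^bsub>R\<^esub> PIdl\<^bsub>R\<^esub> b"
      unfolding set_add_def' cgenideal_def by blast
  qed
qed

text \<open>If the sum of a family lies in the union, it lies in a single member of
  \<open>C\<close>, and that graded member already contains all components. The chain condition
  serves to make the union an ideal.\<close>

lemma graded_ideal_chain_Union:
  assumes "C \<noteq> {}" and C: "subset.chain {J. graded_ideal G R A J} C"
  shows "graded_ideal G R A (\<Union>C)"
proof -
  have gr: "graded_ideal G R A J" if "J \<in> C" for J
    using that C by (auto simp: subset_chain_def)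
  have "subset.chain {J. ideal J R} C"
    using C by (auto simp: subset_chain_def graded_ideal_def)
  then have I: "ideal (\<Union>C) R"
    using R.chain_Union_is_ideal[of C] assms(1) by simp
  show ?thesis
    unfolding graded_ideal_iff[OF I] using gr graded_ideal_iff
    by (meson UnionE UnionI graded_ideal_def)
qed

section \<open>Powers of homogeneous elements and Krull's argument\<close>

lemma homogeneous_nat_pow:
  assumes a: "a \<in> homogeneous G A" and "n > 0"
  shows "a [^]\<^bsub>R\<^esub> (n::nat) \<in> homogeneous G A"
  using \<open>n > 0\<close>
\<comment> \<open>Starting at exponent 1 leaves only closure of homogeneous elements under products
  to use, and nothing about the degree of the unit.\<close>
proof (induction n rule: nat_induct_non_zero)
  case 1
  then show ?case using a homogeneous_subset by (auto simp: subset_iff)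
next
  case (Suc n)
  then show ?case using a graded_mult by (fastforce simp: homogeneous_def)
qed

lemma graded_prime_nat_pow:
  assumes p: "graded_prime G R A p" and a: "a \<in> homogeneous G A" and "n > 0"
    and "a [^]\<^bsub>R\<^esub> (n::nat) \<in> p"
  shows "a \<in> p"
  using \<open>n > 0\<close> assms(4)
proof (induction n rule: nat_induct_non_zero)
  case 1
  then show ?case using a homogeneous_subset by (auto simp: subset_iff)
next
  case (Suc n)
  then show ?case
    using p a homogeneous_nat_pow[OF a \<open>0 < n\<close>] by (auto simp: graded_prime_def)
qed

lemma graded_prime_avoiding_powers:
  assumes J: "graded_ideal G R A J" and a: "a \<in> homogeneous G A"
    and nJ: "\<And>n::nat. n > 0 \<Longrightarrow> a [^]\<^bsub>R\<^esub> n \<notin> J"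
  obtains p where "graded_prime G R A p" "J \<subseteq> p" "a \<notin> p"
proof -
  define F where
    "F = {I. graded_ideal G R A I \<and> J \<subseteq> I \<and> (\<forall>n::nat. n > 0 \<longrightarrow> a [^]\<^bsub>R\<^esub> n \<notin> I)}"
  have aR: "a \<in> carrier R" using a homogeneous_subset by blast
  have "\<exists>M\<in>F. \<forall>K\<in>F. M \<subseteq> K \<longrightarrow> K = M"
  proof (rule subset_Zorn_nonempty)
    show "F \<noteq> {}" using J nJ by (auto simp: F_def)
    fix C assume C: "C \<noteq> {}" "subset.chain F C"
    then have "graded_ideal G R A (\<Union>C)"
      by (intro graded_ideal_chain_Union) (auto simp: subset_chain_def F_def)
    moreover have CF: "C \<subseteq> F" using C(2) by (simp add: subset_chain_def)
    then have "J \<subseteq> \<Union>C" using C(1) unfolding F_def by blast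
    moreover have "\<forall>n::nat. n > 0 \<longrightarrow> a [^]\<^bsub>R\<^esub> n \<notin> \<Union>C" using CF unfolding F_def by blast
    ultimately show "\<Union>C \<in> F" by (simp add: F_def)
  qed
  then obtain p where p: "p \<in> F" and max: "\<And>K. K \<in> F \<Longrightarrow> p \<subseteq> K \<Longrightarrow> K = p" by blast
  have gr: "graded_ideal G R A p" and Jp: "J \<subseteq> p"
    and np: "\<And>n::nat. n > 0 \<Longrightarrow> a [^]\<^bsub>R\<^esub> n \<notin> p"
    using p by (auto simp: F_def)
  have pI: "ideal p R" using gr by (simp add: graded_ideal_def)
  have ap: "a \<notin> p" using np[of 1] aR by simp
  \<comment> \<open>The enlarged ideal is graded because \<open>b\<close> is homogeneous, contains
    \<open>J\<close>, and is strictly larger than \<open>p\<close>. By maximality it is outside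
    \<open>F\<close>, so it must contain a positive power of \<open>a\<close>.\<close>
  have power: "\<exists>n::nat. n > 0 \<and> a [^]\<^bsub>R\<^esub> n \<in> p <+>\<^bsub>R\<^esub> PIdl\<^bsub>R\<^esub> b"
    if b: "b \<in> homogeneous G A" "b \<notin> p" for b
  proof (rule ccontr)
    assume n: "\<not> ?thesis"
    have bR: "b \<in> carrier R" using b homogeneous_subset by blast
    note sub = R.cgenideal_sum_contains[OF pI bR]
    have "p <+>\<^bsub>R\<^esub> PIdl\<^bsub>R\<^esub> b \<in> F"
      using n Jp sub graded_ideal_sum_cgenideal[OF gr b(1)] unfolding F_def by blast
    then show False using max sub b(2) by blast
  qed
  have "b \<in> p \<or> c \<in> p"
    if bc: "b \<in> homogeneous G A" "c \<in> homogeneous G A" "b \<otimes>\<^bsub>R\<^esub> c \<in> p" for b c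
  proof (rule ccontr)
    assume "\<not> ?thesis"
    then obtain n m :: nat where nm: "n > 0" "a [^]\<^bsub>R\<^esub> n \<in> p <+>\<^bsub>R\<^esub> PIdl\<^bsub>R\<^esub> b"
        "a [^]\<^bsub>R\<^esub> m \<in> p <+>\<^bsub>R\<^esub> PIdl\<^bsub>R\<^esub> c"
      using power bc by meson
    \<comment> \<open>The product is \<open>a\<close> to the power \<open>n + m\<close>; positivity
      of \<open>n\<close> alone makes this exponent positive, contradicting
      \<open>np\<close>.\<close>
    then have "a [^]\<^bsub>R\<^esub> n \<otimes>\<^bsub>R\<^esub> a [^]\<^bsub>R\<^esub> m \<in> p"
      using R.sum_cgenideal_mult_mem[OF pI _ _ bc(3)] bc homogeneous_subset by blast
    then show False using np[of "n + m"] nm(1) aR by (simp add: R.nat_pow_mult)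
  qed
  moreover have "p \<noteq> carrier R" using ap aR by blast
  ultimately have "graded_prime G R A p" using gr by (simp add: graded_prime_def)
  then show thesis using that Jp ap by blast
qed

section \<open>Graded radicals as vanishing ideals of closed sets\<close>

text \<open>The carrier is included because \<open>\<Inter>{}\<close> is the universe of the type.\<close>

definition vanishing_ideal :: "'a set set \<Rightarrow> 'a set" where
  "vanishing_ideal C = carrier R \<inter> \<Inter>C"

lemma vanishing_ideal_antimono: "C \<subseteq> D \<Longrightarrow> vanishing_ideal D \<subseteq> vanishing_ideal C"
  by (auto simp: vanishing_ideal_def)

text \<open>Both inclusions work componentwise. A component with a positive power in
  \<open>J\<close> lies in every graded prime above \<open>J\<close>. Conversely, a component
  without such a power is avoided by some graded prime above \<open>J\<close>, although that prime,
  being graded, contains every component of \<open>x\<close>.\<close>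

lemma graded_radical_eq_vanishing_ideal:
  assumes J: "graded_ideal G R A J"
  shows "graded_radical G R A J = vanishing_ideal (graded_V G R A J)"
proof
  show "graded_radical G R A J \<subseteq> vanishing_ideal (graded_V G R A J)"
  proof
    fix x assume "x \<in> graded_radical G R A J"
    then obtain f where f: "f \<in> families" "x = family_sum R (carrier G) f"
        and pow: "\<And>g. g \<in> carrier G \<Longrightarrow> \<exists>n::nat. n > 0 \<and> f g [^]\<^bsub>R\<^esub> n \<in> J"
      unfolding graded_radical_def by blast
    have "x \<in> p" if p: "graded_prime G R A p" "J \<subseteq> p" for p
      unfolding f(2)
    proof (rule family_sum_mem[OF _ f(1)])
      show "ideal p R" using p by (simp add: graded_prime_def graded_ideal_def)
      fix g assume g: "g \<in> carrier G"
      then have "f g \<in> homogeneous G A" using family_mem[OF f(1)] by (auto simp: homogeneous_def)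
      then show "f g \<in> p" using pow[OF g] graded_prime_nat_pow p by blast
    qed
    then show "x \<in> vanishing_ideal (graded_V G R A J)"
      using f family_sum_closed
      by (auto simp: vanishing_ideal_def graded_V_def graded_Spec_def)
  qed
  show "vanishing_ideal (graded_V G R A J) \<subseteq> graded_radical G R A J"
  proof
    fix x assume x: "x \<in> vanishing_ideal (graded_V G R A J)"
    then obtain f where f: "f \<in> families" "x = family_sum R (carrier G) f"
      using family_sum_ex by (metis IntD1 vanishing_ideal_def)
    have "\<exists>n::nat. n > 0 \<and> f g [^]\<^bsub>R\<^esub> n \<in> J" if g: "g \<in> carrier G" for g
    proof (rule ccontr)
      assume n: "\<not> ?thesis"
      have "f g \<in> homogeneous G A" using family_mem[OF f(1) g] g by (auto simp: homogeneous_def)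
      then obtain p where p: "graded_prime G R A p" "J \<subseteq> p" "f g \<notin> p"
        using graded_prime_avoiding_powers[OF J] n by blast
      then have "x \<in> p" using x by (auto simp: vanishing_ideal_def graded_V_def graded_Spec_def)
      then show False
        using p f g graded_ideal_iff by (auto simp: graded_prime_def graded_ideal_def)
    qed
    then show "x \<in> graded_radical G R A J" using f by (auto simp: graded_radical_def)
  qed
qed

lemma graded_ideal_vanishing_ideal:
  assumes "C \<subseteq> graded_Spec G R A"
  shows "graded_ideal G R A (vanishing_ideal C)"
proof -
  \<comment> \<open>Inserting the carrier keeps the intersected set nonempty, which covers
    \<open>C = {}\<close>.\<close>
  have "graded_ideal G R A (\<Inter>(insert (carrier R) C))"
    using assms graded_ideal_carrier
    by (intro graded_ideal_Inter) (auto simp: graded_Spec_def graded_prime_def)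
  then show ?thesis by (simp add: vanishing_ideal_def)
qed

text \<open>The usual Galois connection identity: \<open>J\<close> lies in the vanishing ideal of
  its own closed set, and that ideal lies in each prime of the set.\<close>

lemma graded_V_vanishing_ideal:
  assumes "graded_ideal G R A J"
  shows "graded_V G R A (vanishing_ideal (graded_V G R A J)) = graded_V G R A J"
proof -
  have "J \<subseteq> carrier R" using assms ideal.Icarr by (auto simp: graded_ideal_def)
  then show ?thesis by (auto simp: vanishing_ideal_def graded_V_def)
qed

text \<open>The radical of a graded ideal depends only on its closed set, and passing to the
  vanishing ideal does not change that set.\<close>

lemma graded_radical_ideal_vanishing_ideal:
  assumes "graded_ideal G R A J"
  shows "graded_radical_ideal G R A (vanishing_ideal (graded_V G R A J))"
proof -
  have "graded_ideal G R A (vanishing_ideal (graded_V G R A J))"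
    by (rule graded_ideal_vanishing_ideal) (auto simp: graded_V_def)
  then show ?thesis
    using assms
    by (simp add: graded_radical_ideal_def graded_radical_eq_vanishing_ideal
        graded_V_vanishing_ideal)
qed

section \<open>Transfer of the chain conditions\<close>

lemma noetherian_space_iff_acc_radical:
  "noetherian_space (graded_zariski G R A) \<longleftrightarrow> acc_for (graded_radical_ideal G R A)"
proof
  assume N: "noetherian_space (graded_zariski G R A)"
  show "acc_for (graded_radical_ideal G R A)"
    unfolding acc_for_def
  proof (intro allI impI)
    fix J :: "nat \<Rightarrow> 'a set"
    assume "(\<forall>n. graded_radical_ideal G R A (J n)) \<and> (\<forall>n. J n \<subseteq> J (Suc n))"
    then have J: "\<And>n. graded_radical_ideal G R A (J n)" "\<And>n. J n \<subseteq> J (Suc n)" by auto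
    have "closedin (graded_zariski G R A) (graded_V G R A (J n))" for n
      using J(1) closedin_zariski_iff by (auto simp: graded_radical_ideal_def)
    moreover have "graded_V G R A (J (Suc n)) \<subseteq> graded_V G R A (J n)" for n
      using J(2)[of n] by (auto simp: graded_V_def)
    ultimately obtain N where N: "\<forall>n\<ge>N. graded_V G R A (J n) = graded_V G R A (J N)"
      using N[unfolded noetherian_space_def, rule_format, of "\<lambda>n. graded_V G R A (J n)"] by auto
    \<comment> \<open>A graded radical ideal is recovered from its closed set, so the ideals become
      constant together with the closed sets.\<close>
    have "J n = vanishing_ideal (graded_V G R A (J n))" for n
      using J(1)[of n] graded_radical_eq_vanishing_ideal by (auto simp: graded_radical_ideal_def)
    then show "\<exists>N. \<forall>n\<ge>N. J n = J N" using N by metis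
  qed
next
  assume acc: "acc_for (graded_radical_ideal G R A)"
  show "noetherian_space (graded_zariski G R A)"
    unfolding noetherian_space_def
  proof (intro allI impI)
    fix C :: "nat \<Rightarrow> 'a set set"
    assume "(\<forall>n. closedin (graded_zariski G R A) (C n)) \<and> (\<forall>n. C (Suc n) \<subseteq> C n)"
    then have C: "\<And>n. \<exists>J. graded_ideal G R A J \<and> C n = graded_V G R A J"
        "\<And>n. C (Suc n) \<subseteq> C n"
      by (auto simp: closedin_zariski_iff)
    have "graded_radical_ideal G R A (vanishing_ideal (C n))" for n
      using C(1)[of n] graded_radical_ideal_vanishing_ideal by auto
    then obtain N where N: "\<forall>n\<ge>N. vanishing_ideal (C n) = vanishing_ideal (C N)"
      using acc[unfolded acc_for_def, rule_format, of "\<lambda>n. vanishing_ideal (C n)"]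
        vanishing_ideal_antimono[OF C(2)] by auto
    \<comment> \<open>Conversely, a closed set is recovered from its vanishing ideal.\<close>
    have "C n = graded_V G R A (vanishing_ideal (C n))" for n
      using C(1)[of n] graded_V_vanishing_ideal by auto
    then show "\<exists>N. \<forall>n\<ge>N. C n = C N" using N by metis
  qed
qed

end

theorem proposition2p2:
  fixes G :: "('g, 'm) monoid_scheme"
    and R :: "('a, 'n) ring_scheme"
    and A :: "'g \<Rightarrow> 'a set"
  assumes "graded_ring G R A"
  shows "(noetherian_space (graded_zariski G R A) \<longleftrightarrow> acc_for (graded_radical_ideal G R A)) \<and>
    (graded_noetherian G R A \<longrightarrow> noetherian_space (graded_zariski G R A))"
proof -
  interpret graded_ring G R A by (rule assms)
  \<comment> \<open>A chain of graded radical ideals is in particular a chain of graded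
    ideals.\<close>
  have "acc_for (graded_radical_ideal G R A)" if "graded_noetherian G R A"
    using that by (auto simp: graded_noetherian_def acc_for_def graded_radical_ideal_def)
  then show ?thesis using noetherian_space_iff_acc_radical by blast
qed

end
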